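(* Let $V$ be a countable set with at least two elements. Let $(K_t)_{t\ge1}$ be a sequence of Markov transition operators on $V$ and $(\pi_t)_{t\ge1}$ a sequence of finite positive measures on $V$ such that $\{(K_t,\pi_t)\}_{t\ge1}$ is a finite non-decreasing environment. Let $\lambda_t=\lambda(Q_t,\pi_t)$ be the second highest eigenvalue of $Q_t=K_t^*K_t$, where $K_t^*$ is the adjoint of $K_t$ on $\ell^2(\pi_t)$. Then $$\forall t\ge0,\ \forall f\in\ell^2(\pi_t),\quad \operatorname{Var}_{\tilde\pi_1}(K_{0,t}f)\le\frac{\pi_t(V)}{\pi_1(V)}\operatorname{Var}_{\tilde\pi_t}(f)\prod_{s=1}^t\lambda_s,$$ and the operator $f\mapsto K_{0,t}f-\tilde\pi_1(K_{0,t}f)$ satisfies $$\left\|K_{0,t}-\tilde\pi_1(K_{0,t}\,\cdot)\right\|_{\ell^2(\tilde\pi_t)\to\ell^2(\tilde\pi_1)}\le\sqrt{\frac{\pi_t(V)}{\pi_1(V)}\prod_{s=1}^t\lambda_s}.$$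
   Context: A Markov transition operator $K$ on $V$ is a map $K:V\times V\to[0,1]$ with $\sum_y K(x,y)=1$ for all $x$; it acts on functions by $(Kf)(x)=\sum_y K(x,y)f(y)$ and on measures by $(\mu K)(y)=\sum_x\mu(x)K(x,y)$. $K_{0,t}=K_1K_2\cdots K_t$, $K_{0,0}=I$, and $\pi_0:=\pi_1$. Finite non-decreasing environment: the $\pi_t$ are positive measures ($\pi_t(x)>0$ for all $x$) with, for all $t\ge1$: $\pi_tK_t=\pi_t$; $\pi_t(V)<+\infty$; $\pi_{t+1}(x)\ge\pi_t(x)$ for all $x\in V$. For a finite measure $\pi$, $\tilde\pi:=\pi/\pi(V)$, and $\tilde\pi(f)=\sum_xf(x)\tilde\pi(x)$, $\operatorname{Var}_{\tilde\pi}(f)=\tilde\pi(f^2)-\tilde\pi(f)^2$. The number $\lambda(Q,\pi)$ (called the second highest eigenvalue of $Q$) is defined variationally by $$1-\lambda(Q,\pi)=\inf\left\{\frac{\mathcal E_{Q,\tilde\pi}(f,f)}{\operatorname{Var}_{\tilde\pi}(f)}\;\Big|\;f\in\ell^2(\tilde\pi),\ f\text{ non-constant}\right\},$$ where $\mathcal E_{Q,\tilde\pi}(f,f)=\langle(I-Q)f,f\rangle_{\tilde\pi}=\frac12\sum_{x,y}(f(x)-f(y))^2Q(x,y)\tilde\pi(x)$. *)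

theory Defs
  imports "HOL-Analysis.Analysis"
begin

text \<open>The countable set \<open>V\<close> is the universe of a type \<open>'v\<close> of class \<open>countable\<close>; a (finite) measure on \<open>V\<close>
  is given by its point masses \<open>'v \<Rightarrow> real\<close>.\<close>

definition markov_kernel :: "('v \<Rightarrow> 'v \<Rightarrow> real) \<Rightarrow> bool" where
  "markov_kernel K \<longleftrightarrow>
     (\<forall>x y. K x y \<in> {0..1}) \<and> (\<forall>x. (K x has_sum 1) UNIV)"

definition act_fun :: "('v \<Rightarrow> 'v \<Rightarrow> real) \<Rightarrow> ('v \<Rightarrow> real) \<Rightarrow> 'v \<Rightarrow> real" where
  "act_fun K f = (\<lambda>x. \<Sum>\<^sub>\<infinity>y. K x y * f y)"

definition act_meas :: "('v \<Rightarrow> real) \<Rightarrow> ('v \<Rightarrow> 'v \<Rightarrow> real) \<Rightarrow> 'v \<Rightarrow> real" where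
  "act_meas \<mu> K = (\<lambda>y. \<Sum>\<^sub>\<infinity>x. \<mu> x * K x y)"

definition kernel_prod ::
  "('v \<Rightarrow> 'v \<Rightarrow> real) \<Rightarrow> ('v \<Rightarrow> 'v \<Rightarrow> real) \<Rightarrow> 'v \<Rightarrow> 'v \<Rightarrow> real" where
  "kernel_prod K L = (\<lambda>x y. \<Sum>\<^sub>\<infinity>z. K x z * L z y)"

text \<open>\<open>kernel_upto K t\<close> is \<open>K\<^sub>0\<^sub>,\<^sub>t = K\<^sub>1 K\<^sub>2 \<dots> K\<^sub>t\<close>; the value \<open>K 0\<close> is never used.\<close>

primrec kernel_upto ::
  "(nat \<Rightarrow> 'v \<Rightarrow> 'v \<Rightarrow> real) \<Rightarrow> nat \<Rightarrow> 'v \<Rightarrow> 'v \<Rightarrow> real" where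
  "kernel_upto K 0 = (\<lambda>x y. if x = y then 1 else 0)"
| "kernel_upto K (Suc t) = kernel_prod (kernel_upto K t) (K (Suc t))"

definition total_mass :: "('v \<Rightarrow> real) \<Rightarrow> real" where
  "total_mass \<mu> = (\<Sum>\<^sub>\<infinity>x. \<mu> x)"

definition normalized :: "('v \<Rightarrow> real) \<Rightarrow> 'v \<Rightarrow> real" where
  "normalized \<mu> = (\<lambda>x. \<mu> x / total_mass \<mu>)"

definition finite_nondecreasing_environment ::
  "(nat \<Rightarrow> 'v \<Rightarrow> 'v \<Rightarrow> real) \<Rightarrow> (nat \<Rightarrow> 'v \<Rightarrow> real) \<Rightarrow> bool" where
  "finite_nondecreasing_environment K \<pi> \<longleftrightarrow>
     (\<forall>t\<ge>1. markov_kernel (K t) \<and>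
            (\<forall>x. \<pi> t x > 0) \<and>
            act_meas (\<pi> t) (K t) = \<pi> t \<and>
            \<pi> t summable_on UNIV \<and>
            (\<forall>x. \<pi> (t + 1) x \<ge> \<pi> t x))"

definition mean :: "('v \<Rightarrow> real) \<Rightarrow> ('v \<Rightarrow> real) \<Rightarrow> real" where
  "mean \<mu> f = (\<Sum>\<^sub>\<infinity>x. f x * \<mu> x)"

definition Var :: "('v \<Rightarrow> real) \<Rightarrow> ('v \<Rightarrow> real) \<Rightarrow> real" where
  "Var \<mu> f = mean \<mu> (\<lambda>x. (f x)\<^sup>2) - (mean \<mu> f)\<^sup>2"

definition l2 :: "('v \<Rightarrow> real) \<Rightarrow> ('v \<Rightarrow> real) set" where
  "l2 \<mu> = {f. (\<lambda>x. (f x)\<^sup>2 * \<mu> x) summable_on UNIV}"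

definition l2_inner :: "('v \<Rightarrow> real) \<Rightarrow> ('v \<Rightarrow> real) \<Rightarrow> ('v \<Rightarrow> real) \<Rightarrow> real" where
  "l2_inner \<mu> f g = (\<Sum>\<^sub>\<infinity>x. f x * g x * \<mu> x)"

text \<open>For a strictly positive \<open>\<mu>\<close> distinct functions are distinct elements of \<open>\<ell>\<^sup>2(\<mu>)\<close>, so the
  vector \<open>T\<^sup>* g\<close> is uniquely determined as a function; only \<open>g \<in> \<ell>\<^sup>2(\<mu>)\<close> is meaningful.\<close>

definition l2_adjoint ::
  "('v \<Rightarrow> real) \<Rightarrow> (('v \<Rightarrow> real) \<Rightarrow> 'v \<Rightarrow> real) \<Rightarrow> ('v \<Rightarrow> real) \<Rightarrow> 'v \<Rightarrow> real" where
  "l2_adjoint \<mu> T g =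
     (THE h. h \<in> l2 \<mu> \<and> (\<forall>f\<in>l2 \<mu>. l2_inner \<mu> (T f) g = l2_inner \<mu> f h))"

definition dirichlet_form ::
  "(('v \<Rightarrow> real) \<Rightarrow> 'v \<Rightarrow> real) \<Rightarrow> ('v \<Rightarrow> real) \<Rightarrow> ('v \<Rightarrow> real) \<Rightarrow> real" where
  "dirichlet_form Q \<mu> f = l2_inner \<mu> (\<lambda>x. f x - Q f x) f"

definition second_eigenvalue ::
  "(('v \<Rightarrow> real) \<Rightarrow> 'v \<Rightarrow> real) \<Rightarrow> ('v \<Rightarrow> real) \<Rightarrow> real" where
  "second_eigenvalue Q \<pi> =
     1 - Inf {dirichlet_form Q (normalized \<pi>) f / Var (normalized \<pi>) f | f.
                f \<in> l2 (normalized \<pi>) \<and> \<not> f constant_on UNIV}"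

definition l2_norm :: "('v \<Rightarrow> real) \<Rightarrow> ('v \<Rightarrow> real) \<Rightarrow> ennreal" where
  "l2_norm \<mu> f = (if f \<in> l2 \<mu> then ennreal (sqrt (l2_inner \<mu> f f)) else \<infinity>)"

text \<open>The operator norm takes the value \<open>\<infinity>\<close> if \<open>T\<close> is unbounded or does not map \<open>\<ell>\<^sup>2(\<mu>)\<close> into
  \<open>\<ell>\<^sup>2(\<nu>)\<close>.\<close>

definition l2_opnorm ::
  "('v \<Rightarrow> real) \<Rightarrow> ('v \<Rightarrow> real) \<Rightarrow> (('v \<Rightarrow> real) \<Rightarrow> 'v \<Rightarrow> real) \<Rightarrow> ennreal" where
  "l2_opnorm \<mu> \<nu> T = (SUP f\<in>{f \<in> l2 \<mu>. l2_norm \<mu> f \<le> 1}. l2_norm \<nu> (T f))"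

end

theory Submission imports Defs begin

text \<open>
  Put \<open>D\<^sub>t(f) = \<pi>\<^sub>t(V) Var(f)\<close>, the variance being that of \<open>f\<close> under the normalization of \<open>\<pi>\<^sub>t\<close>.
  As \<open>D\<^sub>t(f)\<close> is the minimum over constants \<open>c\<close> of the sum of \<open>(f - c)\<^sup>2\<close> against \<open>\<pi>\<^sub>t\<close>, it is
  non-decreasing in \<open>t\<close>. Since \<open>\<langle>(I - K\<^sup>*K)f, f\<rangle> = Var(f) - Var(Kf)\<close>, the variational definition of
  \<open>\<lambda>\<^sub>t\<close> says exactly that \<open>D\<^sub>t(K\<^sub>t f) \<le> \<lambda>\<^sub>t D\<^sub>t(f)\<close>. Alternating the two inequalities gives
  \<open>D\<^sub>1(K\<^sub>1 \<dots> K\<^sub>t f) \<le> \<lambda>\<^sub>1 \<dots> \<lambda>\<^sub>t D\<^sub>t(f)\<close>.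
\<close>

section \<open>Summation and square-summability\<close>

lemma summable_on_real_dominated:
  fixes f g :: "'a \<Rightarrow> real"
  assumes "g summable_on A" "\<And>x. x \<in> A \<Longrightarrow> \<bar>f x\<bar> \<le> g x"
  shows "f summable_on A"
  unfolding summable_on_iff_abs_summable_on_real[of f]
  using assms by (intro Infinite_Sum.abs_summable_on_comparison_test'[of g]) auto

text \<open>Joint summability makes both iterated sums equal to the double sum. The form with
  \<open>has_sum\<close> delivers the convergence of the outer sum together with the exchange of
  order.\<close>

lemma fubini_real:
  fixes F :: "'a \<Rightarrow> 'b \<Rightarrow> real"
  assumes F: "(\<lambda>(x,y). F x y) summable_on UNIV"
  shows "F x summable_on UNIV"
    and "((\<lambda>x. \<Sum>\<^sub>\<infinity>y. F x y) has_sum (\<Sum>\<^sub>\<infinity>y. \<Sum>\<^sub>\<infinity>x. F x y)) UNIV"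
proof -
  have F': "(\<lambda>(x,y). F x y) summable_on UNIV \<times> UNIV" using F by simp
  show 1: "F x summable_on UNIV" for x
    using summable_on_SigmaD1[OF F'] by simp
  have "((\<lambda>x. \<Sum>\<^sub>\<infinity>y. F x y) has_sum infsum (\<lambda>(x,y). F x y) (UNIV \<times> UNIV)) UNIV"
    using has_sum_SigmaD[OF has_sum_infsum[OF F'], of "\<lambda>x. \<Sum>\<^sub>\<infinity>y. F x y"] 1 by simp
  then show "((\<lambda>x. \<Sum>\<^sub>\<infinity>y. F x y) has_sum (\<Sum>\<^sub>\<infinity>y. \<Sum>\<^sub>\<infinity>x. F x y)) UNIV"
    using infsum_swap_banach[OF F'] infsumI by metis
qed

lemma abs_mult_le_sum_squares: "\<bar>a * b\<bar> \<le> a\<^sup>2 + b\<^sup>2" for a b :: real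
  using sum_squares_bound[of "\<bar>a\<bar>" "\<bar>b\<bar>"] abs_ge_zero[of "a * b"]
  unfolding abs_mult power2_abs by linarith

lemma l2_mult_summable:
  assumes "\<And>x. \<mu> x \<ge> 0" "f \<in> l2 \<mu>" "g \<in> l2 \<mu>"
  shows "(\<lambda>x. f x * g x * \<mu> x) summable_on UNIV"
proof (rule summable_on_real_dominated)
  show "(\<lambda>x. (f x)\<^sup>2 * \<mu> x + (g x)\<^sup>2 * \<mu> x) summable_on UNIV"
    using assms by (intro summable_on_add) (auto simp: l2_def)
  fix x
  show "\<bar>f x * g x * \<mu> x\<bar> \<le> (f x)\<^sup>2 * \<mu> x + (g x)\<^sup>2 * \<mu> x"
    using mult_right_mono[OF abs_mult_le_sum_squares assms(1)[of x]]
    by (simp add: abs_mult assms(1) flip: distrib_right)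
qed

lemma l2_const:
  assumes "\<mu> summable_on UNIV"
  shows "(\<lambda>_. c) \<in> l2 \<mu>"
  using assms by (auto simp: l2_def intro: summable_on_cmult_right)

lemma l2_summable:
  assumes "\<And>x. \<mu> x \<ge> 0" "\<mu> summable_on UNIV" "f \<in> l2 \<mu>"
  shows "(\<lambda>x. f x * \<mu> x) summable_on UNIV"
  using l2_mult_summable[OF assms(1,3) l2_const[OF assms(2), of 1]] by simp

lemma l2_antimono:
  assumes "\<And>x. 0 \<le> \<mu> x" "\<And>x. \<mu> x \<le> \<nu> x"
  shows "l2 \<nu> \<subseteq> l2 \<mu>"
  using assms by (auto simp: l2_def intro!: mult_left_mono elim!: summable_on_comparison_test)

text \<open>Point indicators serve twice: as test functions that recover the values of an adjoint,
  and as non-constant functions on a space with two points.\<close>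

lemma l2_indicator: "(indicator {a} :: 'v \<Rightarrow> real) \<in> l2 \<mu>"
proof -
  have "((\<lambda>x. (indicator {a} x)\<^sup>2 * \<mu> x) has_sum \<mu> a) UNIV"
    by (rule has_sum_finite_neutralI[of "{a}"]) auto
  then show ?thesis by (auto simp: l2_def summable_on_def)
qed

lemma l2_inner_indicator: "l2_inner \<mu> (indicator {a}) h = h a * \<mu> a"
proof -
  have "((\<lambda>x. indicator {a} x * h x * \<mu> x) has_sum h a * \<mu> a) UNIV"
    by (rule has_sum_finite_neutralI[of "{a}"]) auto
  then show ?thesis by (simp add: l2_inner_def infsumI)
qed

text \<open>The square is expanded and summed termwise. With \<open>\<mu>\<close> merely nonnegative
  and \<open>M\<close> free, it covers both the measures \<pi> and the rows \<open>K x\<close> of a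
  kernel.\<close>

lemma square_deviation_has_sum:
  assumes "\<And>x. \<mu> x \<ge> 0" "(\<mu> has_sum M) UNIV" "f \<in> l2 \<mu>"
  shows "((\<lambda>x. (f x - c)\<^sup>2 * \<mu> x) has_sum
           (mean \<mu> (\<lambda>x. (f x)\<^sup>2) - 2 * c * mean \<mu> f + c\<^sup>2 * M)) UNIV"
proof -
  have "((\<lambda>x. (f x)\<^sup>2 * \<mu> x + (- 2 * c) * (f x * \<mu> x) + c\<^sup>2 * \<mu> x) has_sum
           (mean \<mu> (\<lambda>x. (f x)\<^sup>2) + (- 2 * c) * mean \<mu> f + c\<^sup>2 * M)) UNIV"
    unfolding mean_def
    using assms l2_summable[OF assms(1) _ assms(3)]
    by (intro has_sum_add has_sum_cmult_right has_sum_infsum)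
       (auto simp: l2_def summable_on_def)
  then show ?thesis by (simp add: power2_diff algebra_simps)
qed

lemma mean_normalized: "mean (normalized \<mu>) f = mean \<mu> f / total_mass \<mu>"
  unfolding mean_def normalized_def
  using infsum_cmult_left'[of "\<lambda>x. f x * \<mu> x" "inverse (total_mass \<mu>)" UNIV]
  by (simp add: field_simps)

lemma l2_inner_normalized: "l2_inner (normalized \<mu>) f g = l2_inner \<mu> f g / total_mass \<mu>"
  using mean_normalized[of \<mu> "\<lambda>x. f x * g x"] by (simp add: mean_def l2_inner_def)

lemma l2_normalized:
  assumes "total_mass \<mu> > 0"
  shows "l2 (normalized \<mu>) = l2 \<mu>"
  using summable_on_cmult_left'[of "inverse (total_mass \<mu>)" "\<lambda>x. (_ x)\<^sup>2 * \<mu> x" UNIV] assms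
  by (simp add: l2_def normalized_def divide_inverse mult.assoc)

section \<open>Variance under a finite positive measure\<close>

locale finite_positive_measure =
  fixes \<mu> :: "'v \<Rightarrow> real"
  assumes pos: "\<mu> x > 0" and summable: "\<mu> summable_on UNIV"
begin

lemma nonneg: "\<mu> x \<ge> 0"
  using pos[of x] by simp

lemma has_total_mass: "(\<mu> has_sum total_mass \<mu>) UNIV"
  using summable by (simp add: total_mass_def)

lemma total_mass_pos: "total_mass \<mu> > 0"
proof -
  \<comment> \<open>Here \<open>undefined\<close> is just some point of the space: a total mass of
    zero would force \<open>\<mu>\<close> to vanish there.\<close>
  have "total_mass \<mu> \<noteq> 0"
    using nonneg_infsum_le_0D[of \<mu> UNIV undefined] summable pos nonneg
    by (metis UNIV_I less_irrefl order_refl total_mass_def)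
  then show ?thesis
    using infsum_nonneg[of UNIV \<mu>] nonneg by (simp add: total_mass_def)
qed

lemma total_mass_normalized: "total_mass (normalized \<mu>) = 1"
  using mean_normalized[of \<mu> "\<lambda>_. 1"] total_mass_pos
  by (simp add: mean_def total_mass_def)

text \<open>Bias-variance decomposition: the choice of \<open>c\<close> enters only through its
  squared distance to the mean, so the mean is the best constant.\<close>

lemma bias_variance_has_sum:
  assumes "f \<in> l2 \<mu>"
  shows "((\<lambda>x. (f x - c)\<^sup>2 * \<mu> x) has_sum
           total_mass \<mu> * (Var (normalized \<mu>) f + (mean (normalized \<mu>) f - c)\<^sup>2)) UNIV"
proof -
  have "mean \<mu> (\<lambda>x. (f x)\<^sup>2) - 2 * c * mean \<mu> f + c\<^sup>2 * total_mass \<mu>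
      = total_mass \<mu> * (Var (normalized \<mu>) f + (mean (normalized \<mu>) f - c)\<^sup>2)"
    using total_mass_pos by (simp add: Var_def mean_normalized power2_eq_square field_simps)
  then show ?thesis
    using square_deviation_has_sum[OF nonneg has_total_mass assms, of c] by simp
qed

lemma Var_has_sum:
  assumes "f \<in> l2 \<mu>"
  shows "((\<lambda>x. (f x - mean (normalized \<mu>) f)\<^sup>2 * \<mu> x) has_sum
           total_mass \<mu> * Var (normalized \<mu>) f) UNIV"
  using bias_variance_has_sum[OF assms, of "mean (normalized \<mu>) f"] by simp

lemma Var_nonneg:
  assumes "f \<in> l2 \<mu>"
  shows "Var (normalized \<mu>) f \<ge> 0"
  using has_sum_nonneg[OF Var_has_sum[OF assms]] nonneg total_mass_pos
  by (simp add: zero_le_mult_iff)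

text \<open>A vanishing sum of nonnegative terms has only zero terms, and since all point masses are
  positive, \<open>f\<close> then equals its mean everywhere.\<close>

lemma Var_pos:
  assumes "f \<in> l2 \<mu>" "\<not> f constant_on UNIV"
  shows "Var (normalized \<mu>) f > 0"
proof (rule ccontr)
  assume "\<not> ?thesis"
  then have "total_mass \<mu> * Var (normalized \<mu>) f \<le> 0"
    using total_mass_pos by (simp add: mult_le_0_iff)
  then have "(f x - mean (normalized \<mu>) f)\<^sup>2 * \<mu> x = 0" for x
    using nonneg_has_sum_le_0D[OF Var_has_sum[OF assms(1)], of x] nonneg by simp
  then have "f x = mean (normalized \<mu>) f" for x
    using pos[of x] by (metis less_irrefl mult_eq_0_iff power_not_zero right_minus_eq)
  then show False using assms(2) by (auto simp: constant_on_def)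
qed

text \<open>Both sides are compared through one constant, the mean under \<open>\<nu>\<close>: it is
  optimal for \<open>\<nu>\<close> and merely admissible for \<open>\<mu>\<close>, and the squared
  deviations from it are then compared pointwise.\<close>

lemma Var_mono_measure:
  assumes "finite_positive_measure \<nu>" "\<And>x. \<mu> x \<le> \<nu> x" "f \<in> l2 \<nu>"
  shows "total_mass \<mu> * Var (normalized \<mu>) f \<le> total_mass \<nu> * Var (normalized \<nu>) f"
proof -
  interpret \<nu>: finite_positive_measure \<nu> by fact
  let ?c = "mean (normalized \<nu>) f"
  have f: "f \<in> l2 \<mu>" using l2_antimono[of \<mu> \<nu>] nonneg assms by auto
  have "total_mass \<mu> * Var (normalized \<mu>) f
      \<le> total_mass \<mu> * (Var (normalized \<mu>) f + (mean (normalized \<mu>) f - ?c)\<^sup>2)"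
    using total_mass_pos by simp
  also have "\<dots> \<le> total_mass \<nu> * Var (normalized \<nu>) f"
    by (rule has_sum_mono[OF bias_variance_has_sum[OF f] \<nu>.Var_has_sum[OF assms(3)]])
       (auto intro!: mult_left_mono assms)
  finally show ?thesis .
qed

end

section \<open>A Markov kernel with an invariant measure\<close>

locale stationary = finite_positive_measure \<pi> for \<pi> :: "'v \<Rightarrow> real" +
  fixes K :: "'v \<Rightarrow> 'v \<Rightarrow> real"
  assumes markov: "markov_kernel K" and invariant: "act_meas \<pi> K = \<pi>"
begin

lemma kernel_nonneg: "K x y \<ge> 0" and kernel_le_1: "K x y \<le> 1"
  and kernel_has_sum: "(K x has_sum 1) UNIV"
  using markov by (auto simp: markov_kernel_def)

text \<open>The invariance hypothesis is an equation between values of \<open>infsum\<close>;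
  convergence comes from domination by \<pi>, since kernel entries are at most 1.\<close>

lemma invariant_has_sum: "((\<lambda>x. \<pi> x * K x y) has_sum \<pi> y) UNIV"
proof -
  have "(\<lambda>x. \<pi> x * K x y) summable_on UNIV"
    using kernel_le_1 kernel_nonneg nonneg
    by (intro summable_on_comparison_test[OF summable]) (auto intro: mult_left_le)
  moreover have "(\<Sum>\<^sub>\<infinity>x. \<pi> x * K x y) = \<pi> y"
    using fun_cong[OF invariant, of y] by (simp add: act_meas_def)
  ultimately show ?thesis by (simp add: summable_iff_has_sum_infsum)
qed

text \<open>For absolute values, summing over \<open>x\<close> first collapses the double sum to
  that of \<open>\<pi> y * \<bar>h y\<bar>\<close>, by invariance.\<close>

lemma joint_summable_snd:
  assumes "(\<lambda>x. h x * \<pi> x) summable_on UNIV"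
  shows "(\<lambda>(x,y). \<pi> x * K x y * h y) summable_on UNIV"
proof -
  have "(\<lambda>(y,x). \<pi> x * K x y * \<bar>h y\<bar>) summable_on UNIV \<times> UNIV"
  proof (rule summable_on_SigmaI[where g = "\<lambda>y. \<pi> y * \<bar>h y\<bar>"])
    show "((\<lambda>x. case (y, x) of (y, x) \<Rightarrow> \<pi> x * K x y * \<bar>h y\<bar>) has_sum \<pi> y * \<bar>h y\<bar>) UNIV" for y
      using has_sum_cmult_left[OF invariant_has_sum[of y], of "\<bar>h y\<bar>"] by simp
    show "(\<lambda>y. \<pi> y * \<bar>h y\<bar>) summable_on UNIV"
      using iffD1[OF summable_on_iff_abs_summable_on_real assms] nonneg
      by (simp add: abs_mult mult.commute)
  qed (auto simp: nonneg kernel_nonneg)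
  then have "(\<lambda>(x,y). \<pi> x * K x y * \<bar>h y\<bar>) summable_on UNIV"
    by (subst (asm) summable_on_swap) simp
  then show ?thesis
    by (rule summable_on_real_dominated) (auto simp: abs_mult nonneg kernel_nonneg)
qed

text \<open>Here the sum over \<open>y\<close> comes first and collapses because each row of
  \<open>K\<close> sums to 1.\<close>

lemma joint_summable_fst:
  assumes "(\<lambda>x. h x * \<pi> x) summable_on UNIV" "\<And>x. h x \<ge> 0"
  shows "(\<lambda>(x,y). \<pi> x * K x y * h x) summable_on UNIV"
proof -
  have "(\<lambda>(x,y). \<pi> x * K x y * h x) summable_on UNIV \<times> UNIV"
  proof (rule summable_on_SigmaI[where g = "\<lambda>x. h x * \<pi> x"])
    show "((\<lambda>y. case (x, y) of (x, y) \<Rightarrow> \<pi> x * K x y * h x) has_sum h x * \<pi> x) UNIV" for x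
      using has_sum_cmult_right[OF kernel_has_sum[of x], of "h x * \<pi> x"] by (simp add: mult_ac)
  qed (auto simp: nonneg kernel_nonneg assms)
  then show ?thesis by simp
qed

text \<open>A section of the jointly summable family is summable, and the positive factor
  \<open>\<pi> x\<close> can be divided out. Hence \<open>act_fun K h\<close> is a genuine sum at
  every point.\<close>

lemma act_fun_summable:
  assumes "(\<lambda>x. h x * \<pi> x) summable_on UNIV"
  shows "(\<lambda>y. K x y * h y) summable_on UNIV"
  using fubini_real(1)[OF joint_summable_snd[OF assms], of x] pos[of x]
    summable_on_cmult_right'[of "\<pi> x" "\<lambda>y. K x y * h y" UNIV]
  by (simp add: mult.assoc)

lemma act_fun_mean:
  assumes "(\<lambda>x. h x * \<pi> x) summable_on UNIV"
  shows "((\<lambda>x. act_fun K h x * \<pi> x) has_sum mean \<pi> h) UNIV"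
proof -
  have "(\<Sum>\<^sub>\<infinity>y. \<pi> x * K x y * h y) = act_fun K h x * \<pi> x" for x
    using infsum_cmult_right'[of "\<pi> x" "\<lambda>y. K x y * h y" UNIV]
    by (simp add: act_fun_def mult_ac)
  moreover have "(\<Sum>\<^sub>\<infinity>x. \<pi> x * K x y * h y) = h y * \<pi> y" for y
    using infsumI[OF has_sum_cmult_left[OF invariant_has_sum[of y], of "h y"]]
    by (simp add: mult_ac)
  ultimately show ?thesis
    using fubini_real(2)[OF joint_summable_snd[OF assms]] by (simp add: mean_def)
qed

text \<open>Jensen's inequality for the probability row \<open>K x\<close>: the variance of
  \<open>f\<close> under that row is nonnegative.\<close>

lemma act_fun_square_le:
  assumes "f \<in> l2 \<pi>"
  shows "(act_fun K f x)\<^sup>2 \<le> act_fun K (\<lambda>y. (f y)\<^sup>2) x"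
proof -
  have "f \<in> l2 (K x)"
    using act_fun_summable[of "\<lambda>y. (f y)\<^sup>2" x] assms by (simp add: l2_def mult.commute)
  from has_sum_nonneg[OF square_deviation_has_sum
      [OF kernel_nonneg kernel_has_sum this, of "act_fun K f x"]]
  show ?thesis
    by (simp add: kernel_nonneg mean_def act_fun_def mult.commute power2_eq_square)
qed

text \<open>Contraction on \<open>l2 \<pi>\<close>: the pointwise Jensen bound is summed against
  \<pi>, and invariance preserves the sum of \<open>f\<close> squared.\<close>

lemma act_fun_l2:
  assumes "f \<in> l2 \<pi>"
  shows "act_fun K f \<in> l2 \<pi>"
    and "mean \<pi> (\<lambda>x. (act_fun K f x)\<^sup>2) \<le> mean \<pi> (\<lambda>x. (f x)\<^sup>2)"
proof -
  have *: "((\<lambda>x. act_fun K (\<lambda>y. (f y)\<^sup>2) x * \<pi> x) has_sum mean \<pi> (\<lambda>x. (f x)\<^sup>2)) UNIV"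
    using assms by (intro act_fun_mean) (simp add: l2_def)
  have le: "(act_fun K f x)\<^sup>2 * \<pi> x \<le> act_fun K (\<lambda>y. (f y)\<^sup>2) x * \<pi> x" for x
    by (intro mult_right_mono act_fun_square_le assms nonneg)
  show l2: "act_fun K f \<in> l2 \<pi>"
    unfolding l2_def mem_Collect_eq
    by (rule summable_on_comparison_test[OF has_sum_imp_summable[OF *] le]) (simp add: nonneg)
  then show "mean \<pi> (\<lambda>x. (act_fun K f x)\<^sup>2) \<le> mean \<pi> (\<lambda>x. (f x)\<^sup>2)"
    using has_sum_mono[OF has_sum_infsum * le] by (simp add: l2_def mean_def)
qed

lemma mean_act_fun:
  assumes "f \<in> l2 \<pi>"
  shows "mean \<pi> (act_fun K f) = mean \<pi> f"
  using infsumI[OF act_fun_mean[OF l2_summable[OF nonneg summable assms]]]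
  by (simp add: mean_def)

lemma Var_act_fun_le:
  assumes "f \<in> l2 \<pi>"
  shows "Var (normalized \<pi>) (act_fun K f) \<le> Var (normalized \<pi>) f"
  using act_fun_l2(2)[OF assms] total_mass_pos
  by (simp add: Var_def mean_normalized mean_act_fun[OF assms] divide_right_mono)

section \<open>The time-reversed chain as an explicit kernel for the adjoint\<close>

definition reversal :: "'v \<Rightarrow> 'v \<Rightarrow> real" where
  "reversal y x = \<pi> x * K x y / \<pi> y"

text \<open>The two properties trade places: invariance of \<pi> under \<open>K\<close> gives the
  row sums of \<open>reversal\<close>, and the row sums of \<open>K\<close> give invariance under
  \<open>reversal\<close>. Results on \<open>K\<close> thus transfer to
  \<open>reversal\<close>.\<close>

lemma stationary_reversal: "stationary \<pi> reversal"
proof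
  \<comment> \<open>One term of the nonnegative invariance sum is at most the total; this bounds the
    entries of \<open>reversal\<close> by 1.\<close>
  have le: "\<pi> x * K x y \<le> \<pi> y" for x y
    using has_sum_mono'[OF has_sum_finite[of "{x}"] invariant_has_sum[of y]]
    by (auto simp: nonneg kernel_nonneg)
  have "(reversal y has_sum 1) UNIV" for y
    using has_sum_cmult_left[OF invariant_has_sum[of y], of "inverse (\<pi> y)"] pos[of y]
    by (simp add: reversal_def[abs_def] divide_inverse)
  then show "markov_kernel reversal"
    using le pos nonneg kernel_nonneg by (simp add: markov_kernel_def reversal_def)
  have "(\<Sum>\<^sub>\<infinity>y. \<pi> y * reversal y x) = \<pi> x" for x
    using infsumI[OF has_sum_cmult_right[OF kernel_has_sum[of x], of "\<pi> x"]] pos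
    by (simp add: reversal_def less_imp_neq[symmetric])
  then show "act_meas \<pi> reversal = \<pi>"
    by (simp add: act_meas_def)
qed

text \<open>Both sides are iterated sums of \<open>?F\<close> in opposite orders. Fubini applies
  since \<open>\<bar>f y * g x\<bar>\<close> is at most the sum of the two squares, one jointly
  summable by invariance and the other by the row sums.\<close>

lemma l2_inner_reversal:
  assumes f: "f \<in> l2 \<pi>" and g: "g \<in> l2 \<pi>"
  shows "l2_inner \<pi> (act_fun K f) g = l2_inner \<pi> f (act_fun reversal g)"
proof -
  let ?F = "\<lambda>x y. \<pi> x * K x y * (f y * g x)"
  have "(\<lambda>p. (case p of (x,y) \<Rightarrow> \<pi> x * K x y * (f y)\<^sup>2) + (case p of (x,y) \<Rightarrow> \<pi> x * K x y * (g x)\<^sup>2))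
          summable_on UNIV"
    using f g by (intro summable_on_add joint_summable_snd joint_summable_fst) (auto simp: l2_def)
  then have "(\<lambda>(x,y). ?F x y) summable_on UNIV"
  proof (rule summable_on_real_dominated, clarify)
    fix x y
    have "\<pi> x * K x y * \<bar>f y * g x\<bar> \<le> \<pi> x * K x y * ((f y)\<^sup>2 + (g x)\<^sup>2)"
      by (intro mult_left_mono abs_mult_le_sum_squares) (auto simp: nonneg kernel_nonneg)
    then show "\<bar>?F x y\<bar> \<le> \<pi> x * K x y * (f y)\<^sup>2 + \<pi> x * K x y * (g x)\<^sup>2"
      by (simp add: abs_mult nonneg kernel_nonneg algebra_simps)
  qed
  from infsumI[OF fubini_real(2)[OF this]]
  have "(\<Sum>\<^sub>\<infinity>x. \<Sum>\<^sub>\<infinity>y. ?F x y) = (\<Sum>\<^sub>\<infinity>y. \<Sum>\<^sub>\<infinity>x. ?F x y)" .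
  moreover have "(\<Sum>\<^sub>\<infinity>y. ?F x y) = act_fun K f x * g x * \<pi> x" for x
    using infsum_cmult_right'[of "g x * \<pi> x" "\<lambda>y. K x y * f y" UNIV]
    by (simp add: act_fun_def mult_ac)
  moreover have "(\<Sum>\<^sub>\<infinity>x. ?F x y) = f y * act_fun reversal g y * \<pi> y" for y
    using infsum_cmult_right'[of "f y * \<pi> y" "\<lambda>x. reversal y x * g x" UNIV] pos[of y]
    by (simp add: act_fun_def reversal_def mult_ac)
  ultimately show ?thesis by (simp add: l2_inner_def)
qed

text \<open>The reversal provides existence for the definite description; testing against point
  indicators provides uniqueness.\<close>

lemma l2_adjoint_act_fun:
  assumes g: "g \<in> l2 \<pi>"
  shows "l2_adjoint \<pi> (act_fun K) g = act_fun reversal g"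
  unfolding l2_adjoint_def
proof (rule the_equality)
  show "act_fun reversal g \<in> l2 \<pi> \<and>
      (\<forall>f\<in>l2 \<pi>. l2_inner \<pi> (act_fun K f) g = l2_inner \<pi> f (act_fun reversal g))"
    using stationary.act_fun_l2(1)[OF stationary_reversal g] l2_inner_reversal[OF _ g] by blast
next
  fix h
  assume h: "h \<in> l2 \<pi> \<and> (\<forall>f\<in>l2 \<pi>. l2_inner \<pi> (act_fun K f) g = l2_inner \<pi> f h)"
  show "h = act_fun reversal g"
  proof
    fix a
    have "l2_inner \<pi> (indicator {a}) h = l2_inner \<pi> (indicator {a}) (act_fun reversal g)"
      using h l2_inner_reversal[OF _ g] l2_indicator by metis
    then show "h a = act_fun reversal g a"
      using pos[of a] by (simp add: l2_inner_indicator)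
  qed
qed

section \<open>Dirichlet form and variance contraction in one step\<close>

abbreviation mult_reversibilization :: "('v \<Rightarrow> real) \<Rightarrow> 'v \<Rightarrow> real" where
  "mult_reversibilization \<equiv> l2_adjoint \<pi> (act_fun K) \<circ> act_fun K"

text \<open>Moving the adjoint across the inner product leaves the difference of the second moments
  of \<open>f\<close> and \<open>act_fun K f\<close>; as their means agree, this is the difference
  of the variances.\<close>

lemma dirichlet_form_eq:
  assumes f: "f \<in> l2 \<pi>"
  shows "dirichlet_form mult_reversibilization (normalized \<pi>) f
       = Var (normalized \<pi>) f - Var (normalized \<pi>) (act_fun K f)"
proof -
  let ?h = "act_fun reversal (act_fun K f)"
  note Kf = act_fun_l2(1)[OF f]
  have h: "?h \<in> l2 \<pi>"
    using stationary.act_fun_l2(1)[OF stationary_reversal Kf] .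
  have "l2_inner \<pi> (\<lambda>x. f x - ?h x) f = l2_inner \<pi> f f - l2_inner \<pi> f ?h"
    using infsum_add[OF l2_mult_summable[OF nonneg f f]
        summable_on_uminus[THEN iffD2, OF l2_mult_summable[OF nonneg f h]]]
    by (simp add: l2_inner_def infsum_uminus algebra_simps)
  also have "\<dots> = mean \<pi> (\<lambda>x. (f x)\<^sup>2) - mean \<pi> (\<lambda>x. (act_fun K f x)\<^sup>2)"
    using l2_inner_reversal[OF f Kf] by (simp add: l2_inner_def mean_def power2_eq_square)
  finally show ?thesis
    by (simp add: dirichlet_form_def l2_adjoint_act_fun[OF Kf] l2_inner_normalized Var_def
        mean_normalized mean_act_fun[OF f] diff_divide_distrib)
qed

lemma Var_act_fun_le_second_eigenvalue:
  assumes f: "f \<in> l2 \<pi>"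
  shows "Var (normalized \<pi>) (act_fun K f)
       \<le> second_eigenvalue mult_reversibilization \<pi> * Var (normalized \<pi>) f"
proof (cases "f constant_on UNIV")
  case True
  then obtain c where c: "f = (\<lambda>_. c)" by (auto simp: constant_on_def)
  \<comment> \<open>The infimum ranges over non-constant functions only; for a constant both sides
    vanish or are at most 0, by contraction.\<close>
  have "Var (normalized \<pi>) f = 0"
    using total_mass_normalized
    by (simp add: c Var_def mean_def infsum_cmult_right' power2_eq_square flip: total_mass_def)
  then show ?thesis using Var_act_fun_le[OF f] by simp
next
  case False
  let ?R = "\<lambda>f. dirichlet_form mult_reversibilization (normalized \<pi>) f / Var (normalized \<pi>) f"
  have "Inf {?R f | f. f \<in> l2 (normalized \<pi>) \<and> \<not> f constant_on UNIV} \<le> ?R f"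
  proof (rule cInf_lower)
    \<comment> \<open>The lower bound 0 works because \<open>K\<close> does not increase the
      variance, so every Rayleigh quotient is nonnegative.\<close>
    show "bdd_below {?R f | f. f \<in> l2 (normalized \<pi>) \<and> \<not> f constant_on UNIV}"
      by (rule bdd_belowI[of _ 0])
         (auto simp: l2_normalized[OF total_mass_pos] dirichlet_form_eq Var_act_fun_le Var_nonneg
               intro!: divide_nonneg_nonneg)
  qed (use f False in \<open>auto simp: l2_normalized[OF total_mass_pos]\<close>)
  then have "1 - second_eigenvalue mult_reversibilization \<pi> \<le> ?R f"
    by (simp add: second_eigenvalue_def)
  then show ?thesis
    using Var_pos[OF f False] by (simp add: dirichlet_form_eq[OF f] field_simps)
qed

text \<open>Two points give an indicator of positive variance; the contraction inequality bounds a
  nonnegative variance by the eigenvalue times it.\<close>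

lemma second_eigenvalue_nonneg:
  assumes "\<exists>x y :: 'v. x \<noteq> y"
  shows "second_eigenvalue mult_reversibilization \<pi> \<ge> 0"
proof -
  obtain a b :: 'v where "a \<noteq> b" using assms by blast
  then have "\<not> (indicator {a} :: 'v \<Rightarrow> real) constant_on UNIV"
    by (auto simp: constant_on_def indicator_def) (metis zero_neq_one)
  then have "Var (normalized \<pi>) (indicator {a}) > 0"
    by (intro Var_pos l2_indicator)
  moreover have "0 \<le> second_eigenvalue mult_reversibilization \<pi> * Var (normalized \<pi>) (indicator {a})"
    using Var_act_fun_le_second_eigenvalue[OF l2_indicator, of a]
      Var_nonneg[OF act_fun_l2(1)[OF l2_indicator], of a] by linarith
  ultimately show ?thesis by (simp add: zero_le_mult_iff)
qed

end

section \<open>Composition of kernels acting on functions\<close>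

lemma act_fun_kernel_prod:
  assumes "\<And>x y. A x y \<ge> 0" "\<And>x y. B x y \<ge> 0"
    and "\<And>z. (\<lambda>y. B z y * \<bar>f y\<bar>) summable_on UNIV"
    and "(\<lambda>z. A x z * act_fun B (\<lambda>y. \<bar>f y\<bar>) z) summable_on UNIV"
  shows "(\<lambda>y. kernel_prod A B x y * f y) summable_on UNIV"
    and "act_fun (kernel_prod A B) f x = act_fun A (act_fun B f) x"
proof -
  let ?F = "\<lambda>y z. A x z * B z y * f y"
  \<comment> \<open>Tonelli for \<open>\<bar>f\<bar>\<close>, whose iterated sum converges by the
    last hypothesis, licenses Fubini for the signed \<open>f\<close>.\<close>
  have "(\<lambda>(z,y). A x z * B z y * \<bar>f y\<bar>) summable_on UNIV \<times> UNIV"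
  proof (rule summable_on_SigmaI[OF _ assms(4)])
    show "((\<lambda>y. case (z, y) of (z, y) \<Rightarrow> A x z * B z y * \<bar>f y\<bar>) has_sum
            A x z * act_fun B (\<lambda>y. \<bar>f y\<bar>) z) UNIV" for z
      using has_sum_cmult_right[OF has_sum_infsum[OF assms(3)[of z]], of "A x z"]
      by (simp add: act_fun_def mult_ac)
  qed (simp add: assms)
  then have "(\<lambda>(y,z). A x z * B z y * \<bar>f y\<bar>) summable_on UNIV"
    by (subst (asm) summable_on_swap) simp
  then have "(\<lambda>(y,z). ?F y z) summable_on UNIV"
    by (rule summable_on_real_dominated) (auto simp: abs_mult assms)
  from fubini_real(2)[OF this]
  have *: "((\<lambda>y. \<Sum>\<^sub>\<infinity>z. ?F y z) has_sum (\<Sum>\<^sub>\<infinity>z. \<Sum>\<^sub>\<infinity>y. ?F y z)) UNIV" .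
  have 1: "(\<Sum>\<^sub>\<infinity>z. ?F y z) = kernel_prod A B x y * f y" for y
    using infsum_cmult_left'[of "\<lambda>z. A x z * B z y" "f y" UNIV] by (simp add: kernel_prod_def)
  have 2: "(\<Sum>\<^sub>\<infinity>y. ?F y z) = A x z * act_fun B f z" for z
    using infsum_cmult_right'[of "A x z" "\<lambda>y. B z y * f y" UNIV]
    by (simp add: act_fun_def mult_ac)
  show "(\<lambda>y. kernel_prod A B x y * f y) summable_on UNIV"
    using * unfolding 1 by (rule has_sum_imp_summable)
  show "act_fun (kernel_prod A B) f x = act_fun A (act_fun B f) x"
    using infsumI[OF *] unfolding 1 2 by (simp add: act_fun_def[of A] act_fun_def[of "kernel_prod A B"])
qed

lemma act_fun_identity: "act_fun (\<lambda>x y. if x = y then 1 else 0) f = f"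
proof
  fix x
  have "((\<lambda>y. (if x = y then 1 else 0) * f y) has_sum f x) UNIV"
    by (rule has_sum_finite_neutralI[of "{x}"]) auto
  then show "act_fun (\<lambda>x y. if x = y then 1 else 0) f x = f x"
    by (simp add: act_fun_def infsumI)
qed

section \<open>Iteration along the environment\<close>

locale nondecreasing_environment =
  fixes K :: "nat \<Rightarrow> 'v \<Rightarrow> 'v \<Rightarrow> real" and \<pi> :: "nat \<Rightarrow> 'v \<Rightarrow> real"
  assumes env: "finite_nondecreasing_environment K \<pi>" and pi0: "\<pi> 0 = \<pi> 1"
begin

lemma stationary: "stationary (\<pi> (Suc t)) (K (Suc t))"
  using env by unfold_locales (auto simp: finite_nondecreasing_environment_def)

lemma finite_positive: "finite_positive_measure (\<pi> t)"
  using stationary[of 0] stationary[of "t - 1"] pi0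
  by (cases t) (auto simp: stationary_def)

lemma mono_Suc: "\<pi> t x \<le> \<pi> (Suc t) x"
  using env pi0 by (cases t) (auto simp: finite_nondecreasing_environment_def)

text \<open>Monotonicity of the measures is what keeps the iteration well defined: the image of
  \<open>K (Suc t)\<close> lands in the domain belonging to time \<open>t\<close>.\<close>

lemma l2_Suc_subset: "l2 (\<pi> (Suc t)) \<subseteq> l2 (\<pi> t)"
  using finite_positive_measure.nonneg[OF finite_positive] mono_Suc by (rule l2_antimono)

lemma kernel_upto_nonneg: "kernel_upto K t x y \<ge> 0"
  by (induction t arbitrary: x y)
     (auto simp: kernel_prod_def intro!: infsum_nonneg mult_nonneg_nonneg
        stationary.kernel_nonneg[OF stationary])

text \<open>Summability at time \<open>t\<close> is a hypothesis, so that the first claim can be the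
  induction step for \<open>kernel_upto_summable\<close>, after which the second holds
  outright.\<close>

lemma kernel_upto_Suc_aux:
  assumes summ: "\<And>g x. g \<in> l2 (\<pi> t) \<Longrightarrow> (\<lambda>y. kernel_upto K t x y * g y) summable_on UNIV"
    and f: "f \<in> l2 (\<pi> (Suc t))"
  shows "(\<lambda>y. kernel_upto K (Suc t) x y * f y) summable_on UNIV"
    and "act_fun (kernel_upto K (Suc t)) f x
       = act_fun (kernel_upto K t) (act_fun (K (Suc t)) f) x"
proof -
  interpret stationary "\<pi> (Suc t)" "K (Suc t)" by (rule stationary)
  have absf: "(\<lambda>y. \<bar>f y\<bar>) \<in> l2 (\<pi> (Suc t))" using f by (simp add: l2_def)
  have 1: "(\<lambda>y. K (Suc t) z y * \<bar>f y\<bar>) summable_on UNIV" for z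
    by (intro act_fun_summable l2_summable nonneg summable absf)
  have 2: "(\<lambda>z. kernel_upto K t x z * act_fun (K (Suc t)) (\<lambda>y. \<bar>f y\<bar>) z) summable_on UNIV"
    using l2_Suc_subset act_fun_l2(1)[OF absf] by (intro summ) auto
  show "(\<lambda>y. kernel_upto K (Suc t) x y * f y) summable_on UNIV"
    and "act_fun (kernel_upto K (Suc t)) f x
       = act_fun (kernel_upto K t) (act_fun (K (Suc t)) f) x"
    using act_fun_kernel_prod[where A = "kernel_upto K t" and B = "K (Suc t)" and f = f and x = x,
        OF kernel_upto_nonneg kernel_nonneg 1 2] by simp_all
qed

lemma kernel_upto_summable:
  "f \<in> l2 (\<pi> t) \<Longrightarrow> (\<lambda>y. kernel_upto K t x y * f y) summable_on UNIV"
proof (induction t arbitrary: f x)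
  case 0
  have "((\<lambda>y. (if x = y then 1 else 0) * f y) has_sum f x) UNIV"
    by (rule has_sum_finite_neutralI[of "{x}"]) auto
  then show ?case by (auto intro: has_sum_imp_summable)
next
  case (Suc t)
  show ?case by (rule kernel_upto_Suc_aux(1)[OF Suc.IH Suc.prems])
qed

lemma act_fun_kernel_upto_Suc:
  assumes "f \<in> l2 (\<pi> (Suc t))"
  shows "act_fun (kernel_upto K (Suc t)) f = act_fun (kernel_upto K t) (act_fun (K (Suc t)) f)"
  using kernel_upto_Suc_aux(2)[OF kernel_upto_summable assms] by blast

lemma act_fun_kernel_upto_l2:
  "f \<in> l2 (\<pi> t) \<Longrightarrow> act_fun (kernel_upto K t) f \<in> l2 (\<pi> 1)"
proof (induction t arbitrary: f)
  case 0
  then show ?case by (simp add: act_fun_identity pi0)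
next
  case (Suc t)
  then show ?case
    using stationary.act_fun_l2(1)[OF stationary] l2_Suc_subset
    by (simp only: act_fun_kernel_upto_Suc) blast
qed

definition eigenvalue :: "nat \<Rightarrow> real" where
  "eigenvalue t =
     second_eigenvalue (l2_adjoint (\<pi> t) (act_fun (K t)) \<circ> act_fun (K t)) (\<pi> t)"

lemma prod_eigenvalue_nonneg:
  assumes "\<exists>x y :: 'v. x \<noteq> y"
  shows "(\<Prod>s=1..t. eigenvalue s) \<ge> 0"
proof (rule prod_nonneg)
  fix s assume "s \<in> {1..t}"
  then obtain r where "s = Suc r" by (cases s) auto
  then show "eigenvalue s \<ge> 0"
    using stationary.second_eigenvalue_nonneg[OF stationary assms, of r]
    by (simp add: eigenvalue_def)
qed

text \<open>The induction peels off the last kernel, so \<open>f\<close> must vary: the hypothesis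
  is applied to \<open>act_fun (K (Suc t)) f\<close>. Weighting by total mass makes the change of
  measure cost nothing.\<close>

lemma Var_kernel_upto_le:
  assumes two: "\<exists>x y :: 'v. x \<noteq> y"
  shows "f \<in> l2 (\<pi> t) \<Longrightarrow>
    total_mass (\<pi> 1) * Var (normalized (\<pi> 1)) (act_fun (kernel_upto K t) f)
      \<le> total_mass (\<pi> t) * Var (normalized (\<pi> t)) f * (\<Prod>s=1..t. eigenvalue s)"
proof (induction t arbitrary: f)
  case 0
  then show ?case by (simp add: act_fun_identity pi0)
next
  case (Suc t)
  interpret stationary "\<pi> (Suc t)" "K (Suc t)" by (rule stationary)
  let ?g = "act_fun (K (Suc t)) f"
  let ?P = "\<Prod>s=1..t. eigenvalue s"
  note P = prod_eigenvalue_nonneg[OF two, of t]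
  have g: "?g \<in> l2 (\<pi> (Suc t))" by (rule act_fun_l2(1)[OF Suc.prems])
  have "total_mass (\<pi> 1) * Var (normalized (\<pi> 1)) (act_fun (kernel_upto K (Suc t)) f)
      \<le> total_mass (\<pi> t) * Var (normalized (\<pi> t)) ?g * ?P"
    using Suc.IH[of ?g] g l2_Suc_subset by (auto simp only: act_fun_kernel_upto_Suc[OF Suc.prems])
  \<comment> \<open>First the measure is enlarged, then the contraction is used at time
    \<open>Suc t\<close>; both steps multiply by \<open>?P\<close>, which must be
    nonnegative.\<close>
  also have "\<dots> \<le> total_mass (\<pi> (Suc t)) * Var (normalized (\<pi> (Suc t))) ?g * ?P"
    by (intro mult_right_mono P finite_positive_measure.Var_mono_measure[OF finite_positive]
        finite_positive mono_Suc g)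
  also have "\<dots> \<le> total_mass (\<pi> (Suc t)) * (eigenvalue (Suc t) * Var (normalized (\<pi> (Suc t))) f) * ?P"
    using Var_act_fun_le_second_eigenvalue[OF Suc.prems] total_mass_pos
    by (intro mult_right_mono P mult_left_mono) (auto simp: eigenvalue_def)
  finally show ?case by (simp add: mult_ac)
qed

end

theorem theorem3p6:
  fixes K :: "nat \<Rightarrow> 'v::countable \<Rightarrow> 'v \<Rightarrow> real"
    and \<pi> :: "nat \<Rightarrow> 'v \<Rightarrow> real"
    and Q :: "nat \<Rightarrow> ('v \<Rightarrow> real) \<Rightarrow> 'v \<Rightarrow> real"
    and lam :: "nat \<Rightarrow> real"
  assumes two: "\<exists>x y :: 'v. x \<noteq> y"
    and env: "finite_nondecreasing_environment K \<pi>"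
    and pi0: "\<pi> 0 = \<pi> 1"
    and Q: "\<And>t. t \<ge> 1 \<Longrightarrow> Q t = l2_adjoint (\<pi> t) (act_fun (K t)) \<circ> act_fun (K t)"
    and lam: "\<And>t. t \<ge> 1 \<Longrightarrow> lam t = second_eigenvalue (Q t) (\<pi> t)"
  shows "(\<forall>t. \<forall>f\<in>l2 (\<pi> t).
            Var (normalized (\<pi> 1)) (act_fun (kernel_upto K t) f)
              \<le> total_mass (\<pi> t) / total_mass (\<pi> 1) * Var (normalized (\<pi> t)) f
                  * (\<Prod>s=1..t. lam s))
       \<and> (\<forall>t. l2_opnorm (normalized (\<pi> t)) (normalized (\<pi> 1))
              (\<lambda>f x. act_fun (kernel_upto K t) f x
                       - mean (normalized (\<pi> 1)) (act_fun (kernel_upto K t) f))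
            \<le> ennreal (sqrt (total_mass (\<pi> t) / total_mass (\<pi> 1) * (\<Prod>s=1..t. lam s))))"
proof -
  interpret nondecreasing_environment K \<pi> using env pi0 by unfold_locales
  interpret \<pi>1: finite_positive_measure "\<pi> 1" by (rule finite_positive)
  have P: "(\<Prod>s=1..t. lam s) = (\<Prod>s=1..t. eigenvalue s)" for t
    by (intro prod.cong) (auto simp: lam Q eigenvalue_def)
  have bound: "Var (normalized (\<pi> 1)) (act_fun (kernel_upto K t) f)
      \<le> total_mass (\<pi> t) / total_mass (\<pi> 1) * Var (normalized (\<pi> t)) f * (\<Prod>s=1..t. lam s)"
    if "f \<in> l2 (\<pi> t)" for t f
    using Var_kernel_upto_le[OF two that] \<pi>1.total_mass_pos unfolding P
    by (simp add: field_simps)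
  have "l2_norm (normalized (\<pi> 1)) (\<lambda>x. act_fun (kernel_upto K t) f x
                       - mean (normalized (\<pi> 1)) (act_fun (kernel_upto K t) f))
      \<le> ennreal (sqrt (total_mass (\<pi> t) / total_mass (\<pi> 1) * (\<Prod>s=1..t. lam s)))"
    if f: "f \<in> l2 (normalized (\<pi> t))" and norm: "l2_norm (normalized (\<pi> t)) f \<le> 1" for t f
  proof -
    interpret \<pi>t: finite_positive_measure "\<pi> t" by (rule finite_positive)
    let ?C = "total_mass (\<pi> t) / total_mass (\<pi> 1) * (\<Prod>s=1..t. lam s)"
    let ?g = "act_fun (kernel_upto K t) f"
    let ?h = "\<lambda>x. ?g x - mean (normalized (\<pi> 1)) ?g"
    have f': "f \<in> l2 (\<pi> t)" using f by (simp add: l2_normalized \<pi>t.total_mass_pos)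
    note hs = \<pi>1.Var_has_sum[OF act_fun_kernel_upto_l2[OF f']]
    have h: "?h \<in> l2 (normalized (\<pi> 1))"
      using has_sum_imp_summable[OF hs] unfolding l2_normalized[OF \<pi>1.total_mass_pos] by (simp add: l2_def)
    \<comment> \<open>The squared norm of the centered function is the variance, so the operator
      bound reduces to \<open>bound\<close> on the unit ball.\<close>
    have inner: "l2_inner (normalized (\<pi> 1)) ?h ?h = Var (normalized (\<pi> 1)) ?g"
      using infsumI[OF hs] \<pi>1.total_mass_pos
      unfolding l2_inner_normalized by (simp add: l2_inner_def power2_eq_square)
    have "sqrt (l2_inner (normalized (\<pi> t)) f f) \<le> 1"
      using norm f by (simp add: l2_norm_def flip: ennreal_1)
    then have "mean (normalized (\<pi> t)) (\<lambda>x. (f x)\<^sup>2) \<le> 1"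
      by (simp add: mean_def l2_inner_def power2_eq_square)
    \<comment> \<open>The variance is at most the second moment, which the unit ball bounds by
      1.\<close>
    then have "Var (normalized (\<pi> t)) f \<le> 1"
      unfolding Var_def using zero_le_power2[of "mean (normalized (\<pi> t)) f"] by linarith
    moreover have "?C \<ge> 0"
      using prod_eigenvalue_nonneg[OF two, of t] \<pi>1.total_mass_pos \<pi>t.total_mass_pos
      unfolding P by simp
    ultimately have "?C * Var (normalized (\<pi> t)) f \<le> ?C"
      by (rule mult_left_le)
    then have "Var (normalized (\<pi> 1)) ?g \<le> ?C"
      using bound[OF f'] by (simp add: mult_ac)
    then show ?thesis
      unfolding l2_norm_def inner using h by (simp add: ennreal_leI)
  qed
  then show ?thesis
    using bound unfolding l2_opnorm_def by (auto intro!: SUP_least)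
qed

end
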